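(* Let $\mathbb K$ be a field. The set of matrices $\{\mathbf A_\alpha:\alpha\in\mathbb K((x))\setminus\{0\}\}$ (respectively $\{\mathbf A_\alpha:\alpha\in\mathbb K((\frac1x))\setminus\{0\}\}$) is a group under matrix multiplication, isomorphic to the group $(\mathbb K((x))\setminus\{0\},\cdot)$ (respectively $(\mathbb K((\frac1x))\setminus\{0\},\cdot)$). For all $\alpha,\beta$ in $\mathbb K((x))$ (respectively, in $\mathbb K((\frac1x))$): - $\mathbf A_\alpha\mathbf A_\beta=\mathbf A_{\alpha\cdot\beta}$; - the identity element is $\mathbf A_1=\mathbf I$; - $\mathbf A_\alpha^{-1}=\mathbf A_{1/\alpha}$ (for $\alpha\neq0$, where $1/\alpha$ is the inverse of $\alpha$ in $\mathbb K((x))$, respectively in $\mathbb K((\frac1x))$).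
   Context: $\mathbb L$ is the set of formal Laurent series $\sum_{k=-\infty}^{\infty}\omega_kx^k$ with $\omega_k\in\mathbb K$. $\mathbb K((x))\subset\mathbb L$ consists of those series for which there is $n\in\mathbb Z$ with $\omega_k=0$ for all $k<n$; $\mathbb K((\frac1x))\subset\mathbb L$ consists of those for which there is $n\in\mathbb Z$ with $\omega_k=0$ for all $k>n$. The product of two series has $k$-th coefficient $\sum_{i+j=k}\alpha_i\beta_j$. Both $\mathbb K((x))\setminus\{0\}$ and $\mathbb K((\frac1x))\setminus\{0\}$ are groups under this product. A bi-infinite matrix is an array $\mathbf M=[m_{ij}]_{i,j\in\mathbb Z}$ with entries in $\mathbb K$ ($i$ the row, $j$ the column). The product of $\mathbf M$ and $\mathbf N=[n_{ij}]_{i,j\in\mathbb Z}$ has entries $\sum_{k\in\mathbb Z}m_{ik}n_{kj}$ and is well defined if for all $i,j$ only finitely many of the products $m_{ik}n_{kj}$ are nonzero. $\mathbf I=[\delta_{ij}]_{i,j\in\mathbb Z}$ is the identity matrix. For $\alpha=\sum_k\alpha_kx^k\in\mathbb L$, the Toeplitz matrix $\mathbf A_\alpha$ is the bi-infinite matrix $[\alpha_{i-j}]_{i,j\in\mathbb Z}$. *)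

theory Defs
  imports "HOL-Algebra.Group" "HOL-Library.Groups_Big_Fun"
begin

text \<open>
  A two-sided formal Laurent series over a field is represented by its coefficient function
  \<open>int \<Rightarrow> 'a\<close>, so that \<open>\<omega> k\<close> is the coefficient of \<open>x\<^sup>k\<close>. The two rings of one-sided series are
  subsets of this common type.
\<close>

definition laurent_x :: "(int \<Rightarrow> 'a::field) set"  \<comment> \<open>\<open>K((x))\<close>\<close>
  where "laurent_x = {\<omega>. \<exists>n. \<forall>k<n. \<omega> k = 0}"

definition laurent_inv_x :: "(int \<Rightarrow> 'a::field) set"  \<comment> \<open>\<open>K((1/x))\<close>\<close>
  where "laurent_inv_x = {\<omega>. \<exists>n. \<forall>k>n. \<omega> k = 0}"

definition laurent_zero :: "int \<Rightarrow> 'a::field"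
  where "laurent_zero = (\<lambda>k. 0)"

definition laurent_one :: "int \<Rightarrow> 'a::field"
  where "laurent_one = (\<lambda>k. if k = 0 then 1 else 0)"

text \<open>
  The sum over all \<open>i + j = k\<close>, indexed by \<open>i\<close>. \<^const>\<open>Sum_any\<close> adds the nonzero terms and is \<open>0\<close> by
  convention if there are infinitely many of them; the two lemmas below show that this does not
  happen inside either ring.
\<close>

definition laurent_mult :: "(int \<Rightarrow> 'a::field) \<Rightarrow> (int \<Rightarrow> 'a) \<Rightarrow> (int \<Rightarrow> 'a)"
  where "laurent_mult \<alpha> \<beta> = (\<lambda>k. Sum_any (\<lambda>i. \<alpha> i * \<beta> (k - i)))"

lemma laurent_mult_finite_x:
  assumes "\<alpha> \<in> laurent_x" "\<beta> \<in> laurent_x"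
  shows "finite {i. \<alpha> i * \<beta> (k - i) \<noteq> 0}"
proof -
  obtain m n where "\<forall>i<m. \<alpha> i = 0" "\<forall>i<n. \<beta> i = 0"
    using assms by (auto simp: laurent_x_def)
  then have "{i. \<alpha> i * \<beta> (k - i) \<noteq> 0} \<subseteq> {m..k - n}"
    by (force simp: not_less [symmetric])
  then show ?thesis
    by (rule finite_subset) simp
qed

lemma laurent_mult_finite_inv_x:
  assumes "\<alpha> \<in> laurent_inv_x" "\<beta> \<in> laurent_inv_x"
  shows "finite {i. \<alpha> i * \<beta> (k - i) \<noteq> 0}"
proof -
  obtain m n where "\<forall>i>m. \<alpha> i = 0" "\<forall>i>n. \<beta> i = 0"
    using assms by (auto simp: laurent_inv_x_def)
  then have "{i. \<alpha> i * \<beta> (k - i) \<noteq> 0} \<subseteq> {k - n..m}"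
    by (force simp: not_less [symmetric])
  then show ?thesis
    by (rule finite_subset) simp
qed

text \<open>Bi-infinite matrices are functions \<open>int \<Rightarrow> int \<Rightarrow> 'a\<close>, row index first.\<close>

definition bimat_mult_defined :: "(int \<Rightarrow> int \<Rightarrow> 'a::field) \<Rightarrow> (int \<Rightarrow> int \<Rightarrow> 'a) \<Rightarrow> bool"
  where "bimat_mult_defined M N \<longleftrightarrow> (\<forall>i j. finite {k. M i k * N k j \<noteq> 0})"

text \<open>Only meaningful when \<^const>\<open>bimat_mult_defined\<close> holds.\<close>

definition bimat_mult ::
    "(int \<Rightarrow> int \<Rightarrow> 'a::field) \<Rightarrow> (int \<Rightarrow> int \<Rightarrow> 'a) \<Rightarrow> (int \<Rightarrow> int \<Rightarrow> 'a)"
  where "bimat_mult M N = (\<lambda>i j. Sum_any (\<lambda>k. M i k * N k j))"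

definition bimat_id :: "int \<Rightarrow> int \<Rightarrow> 'a::field"
  where "bimat_id = (\<lambda>i j. if i = j then 1 else 0)"

definition toeplitz :: "(int \<Rightarrow> 'a::field) \<Rightarrow> (int \<Rightarrow> int \<Rightarrow> 'a)"
  where "toeplitz \<alpha> = (\<lambda>i j. \<alpha> (i - j))"

text \<open>In both structures \<open>S\<close> is meant to be \<^const>\<open>laurent_x\<close> or \<^const>\<open>laurent_inv_x\<close>.\<close>

definition laurent_group :: "(int \<Rightarrow> 'a::field) set \<Rightarrow> (int \<Rightarrow> 'a) monoid"
  where "laurent_group S =
    \<lparr>carrier = S - {laurent_zero}, mult = laurent_mult, one = laurent_one\<rparr>"

definition toeplitz_group :: "(int \<Rightarrow> 'a::field) set \<Rightarrow> (int \<Rightarrow> int \<Rightarrow> 'a) monoid"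
  where "toeplitz_group S =
    \<lparr>carrier = toeplitz ` (S - {laurent_zero}), mult = bimat_mult, one = bimat_id\<rparr>"

end

theory Submission
  imports Defs "HOL-Computational_Algebra.Formal_Laurent_Series"
begin

text \<open>
  The series in \<open>K((x))\<close> are the coefficient functions of the library's formal Laurent series, which
  form a field, and the reflection \<open>x \<mapsto> 1/x\<close> carries \<open>K((x))\<close> onto \<open>K((1/x))\<close> and
  respects products. This gives both groups of series. In the \<open>(i, j)\<close> entry of
  \<open>A\<^sub>\<alpha> A\<^sub>\<beta>\<close> the substitution \<open>k = i - l\<close> produces the coefficient of \<open>x\<^bsup>i - j\<^esup>\<close> in
  \<open>\<alpha> \<beta>\<close>, so that the injection \<open>\<alpha> \<mapsto> A\<^sub>\<alpha>\<close> transports the group structure to the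
  Toeplitz matrices.
\<close>

text \<open>Membership in \<open>iso\<close> constrains only carriers and products, so the unit of
  \<open>H\<close> has to be matched separately.\<close>

lemma group_transport:
  assumes "group G" "h \<in> iso G H" "h \<one>\<^bsub>G\<^esub> = \<one>\<^bsub>H\<^esub>"
  shows "group H"
  using group.iso_imp_img_group[OF assms(1,2)] assms(3) by simp

definition fls_nonzero_group :: "'a::field fls monoid"
  where "fls_nonzero_group = \<lparr>carrier = - {0}, monoid.mult = (*), one = 1\<rparr>"

lemma group_fls_nonzero_group: "group fls_nonzero_group"
  unfolding fls_nonzero_group_def
  by (rule groupI) (auto intro: left_inverse)

lemma range_fls_nth: "range fls_nth = laurent_x"
proof (intro subset_antisym subsetI)
  fix \<omega> :: "int \<Rightarrow> 'a"
  assume "\<omega> \<in> range fls_nth"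
  then obtain f where "\<omega> = fls_nth f" by blast
  then have "\<forall>k<fls_subdegree f. \<omega> k = 0" by simp
  then show "\<omega> \<in> laurent_x" unfolding laurent_x_def by blast
next
  fix \<omega> :: "int \<Rightarrow> 'a"
  assume "\<omega> \<in> laurent_x"
  then obtain n where "\<forall>k<n. \<omega> k = 0" by (auto simp: laurent_x_def)
  then have "fls_nth (Abs_fls \<omega>) = \<omega>"
    by (intro ext nth_Abs_fls_lower_bound)
  then show "\<omega> \<in> range fls_nth" by (metis rangeI)
qed

text \<open>Below the subdegrees one of the two factors vanishes, so the support of the summand lies
  in the finite window over which the library product sums.\<close>

lemma fls_nth_times: "fls_nth (f * g) = laurent_mult (fls_nth f) (fls_nth g)"
proof
  fix k
  let ?A = "{fls_subdegree f..k - fls_subdegree g}"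
  have "{i. fls_nth f i * fls_nth g (k - i) \<noteq> 0} \<subseteq> ?A"
    by (force simp: not_less[symmetric])
  then have "Sum_any (\<lambda>i. fls_nth f i * fls_nth g (k - i)) = (\<Sum>i\<in>?A. fls_nth f i * fls_nth g (k - i))"
    by (intro Sum_any.expand_superset) auto
  then show "fls_nth (f * g) k = laurent_mult (fls_nth f) (fls_nth g) k"
    by (simp add: fls_times_nth(2) laurent_mult_def)
qed

text \<open>A bijection matches the two supports; if they are infinite, both sides take the default
  value 0. Identities derived from this therefore hold for arbitrary coefficient functions.\<close>

lemma Sum_any_reindex_bij:
  assumes "bij h"
  shows "Sum_any (\<lambda>x. g (h x)) = Sum_any g"
  by (rule Sum_any.reindex_cong[OF assms, symmetric]) (simp add: fun_eq_iff)

text \<open>Substitute \<open>- i\<close> for the summation index \<open>i\<close>.\<close>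

lemma laurent_mult_reflect:
  "laurent_mult (\<lambda>k. \<alpha> (- k)) (\<lambda>k. \<beta> (- k)) = (\<lambda>k. laurent_mult \<alpha> \<beta> (- k))"
proof
  fix k
  show "laurent_mult (\<lambda>k. \<alpha> (- k)) (\<lambda>k. \<beta> (- k)) k = laurent_mult \<alpha> \<beta> (- k)"
    using Sum_any_reindex_bij[OF bij_uminus, of "\<lambda>i. \<alpha> i * \<beta> (- k - i)"]
    by (simp add: laurent_mult_def)
qed

lemma reflect_laurent_x: "(\<lambda>\<omega> k. \<omega> (- k)) ` laurent_x = laurent_inv_x"
proof (intro subset_antisym subsetI)
  fix \<omega> :: "int \<Rightarrow> 'a"
  assume "\<omega> \<in> (\<lambda>\<omega> k. \<omega> (- k)) ` laurent_x"
  then obtain \<alpha> n where "\<omega> = (\<lambda>k. \<alpha> (- k))" "\<forall>k<n. \<alpha> k = 0"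
    by (auto simp: laurent_x_def)
  then have "\<forall>k > - n. \<omega> k = 0" by auto
  then show "\<omega> \<in> laurent_inv_x" unfolding laurent_inv_x_def by blast
next
  fix \<omega> :: "int \<Rightarrow> 'a"
  assume "\<omega> \<in> laurent_inv_x"
  then obtain n where "\<forall>k>n. \<omega> k = 0" by (auto simp: laurent_inv_x_def)
  then have "\<forall>k < - n. \<omega> (- k) = 0" by auto
  then have "(\<lambda>k. \<omega> (- k)) \<in> laurent_x" unfolding laurent_x_def by blast
  then show "\<omega> \<in> (\<lambda>\<omega> k. \<omega> (- k)) ` laurent_x"
    by (rule rev_image_eqI) simp
qed

lemma group_laurent_x: "group (laurent_group (laurent_x :: (int \<Rightarrow> 'a::field) set))"
proof (rule group_transport[OF group_fls_nonzero_group])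
  have inj: "inj fls_nth" by (simp add: inj_def fls_nth_inject)
  have zero: "fls_nth (0 :: 'a fls) = laurent_zero" by (simp add: laurent_zero_def fun_eq_iff)
  \<comment> \<open>Injectivity lets the image commute with the removal of zero.\<close>
  have im: "fls_nth ` (- {0 :: 'a fls}) = laurent_x - {laurent_zero}"
    by (simp add: Compl_eq_Diff_UNIV image_set_diff[OF inj] range_fls_nth zero)
  show "fls_nth \<in> iso (fls_nonzero_group :: 'a fls monoid) (laurent_group laurent_x)"
    using inj im
    by (intro isoI homI)
      (auto simp: fls_nonzero_group_def laurent_group_def fls_nth_times bij_betw_def
        intro: inj_on_subset)
  show "fls_nth \<one>\<^bsub>fls_nonzero_group\<^esub> = \<one>\<^bsub>laurent_group (laurent_x :: (int \<Rightarrow> 'a) set)\<^esub>"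
    by (simp add: fls_nonzero_group_def laurent_group_def laurent_one_def fun_eq_iff)
qed

lemma group_laurent_inv_x: "group (laurent_group (laurent_inv_x :: (int \<Rightarrow> 'a::field) set))"
proof (rule group_transport[OF group_laurent_x])
  let ?r = "\<lambda>(\<omega> :: int \<Rightarrow> 'a) k. \<omega> (- k)"
  \<comment> \<open>The reflection is its own inverse.\<close>
  have inj: "inj ?r" by (rule inj_on_inverseI[where g = ?r]) simp
  have im: "?r ` (laurent_x - {laurent_zero}) = laurent_inv_x - {laurent_zero}"
    by (simp add: image_set_diff[OF inj] reflect_laurent_x laurent_zero_def)
  show "?r \<in> iso (laurent_group laurent_x) (laurent_group laurent_inv_x)"
    using inj im
    by (intro isoI homI)
      (auto simp: laurent_group_def laurent_mult_reflect bij_betw_def intro: inj_on_subset)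
  show "?r \<one>\<^bsub>laurent_group laurent_x\<^esub> = \<one>\<^bsub>laurent_group laurent_inv_x\<^esub>"
    by (simp add: laurent_group_def laurent_one_def fun_eq_iff)
qed

lemma toeplitz_mult:
  "bimat_mult (toeplitz \<alpha>) (toeplitz \<beta>) = toeplitz (laurent_mult \<alpha> \<beta>)"
proof (intro ext)
  fix i j
  show "bimat_mult (toeplitz \<alpha>) (toeplitz \<beta>) i j = toeplitz (laurent_mult \<alpha> \<beta>) i j"
    using Sum_any_reindex_bij[OF bij_diff[of i], of "\<lambda>l. \<alpha> l * \<beta> (i - j - l)"]
    by (simp add: bimat_mult_def toeplitz_def laurent_mult_def)
qed

text \<open>For fixed \<open>i\<close> and \<open>j\<close>, the injection
  \<open>k \<mapsto> i - k\<close> pulls the finite support of one convolution sum back to that of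
  the matrix entry.\<close>

lemma toeplitz_mult_defined:
  assumes "\<And>k. finite {i. \<alpha> i * \<beta> (k - i) \<noteq> 0}"
  shows "bimat_mult_defined (toeplitz \<alpha>) (toeplitz \<beta>)"
  unfolding bimat_mult_defined_def toeplitz_def
proof (intro allI)
  fix i j
  have "{k. \<alpha> (i - k) * \<beta> (k - j) \<noteq> 0} = (\<lambda>k. i - k) -` {l. \<alpha> l * \<beta> (i - j - l) \<noteq> 0}"
    by auto
  also have "finite \<dots>"
    by (intro finite_vimageI assms bij_is_inj bij_diff)
  finally show "finite {k. \<alpha> (i - k) * \<beta> (k - j) \<noteq> 0}" .
qed

lemma inj_toeplitz: "inj toeplitz"
proof (rule inj_on_inverseI)
  fix \<alpha> :: "int \<Rightarrow> 'a"
  \<comment> \<open>Column 0 of the matrix lists the coefficients of the series.\<close>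
  show "(\<lambda>i. toeplitz \<alpha> i 0) = \<alpha>" by (simp add: toeplitz_def)
qed

lemma toeplitz_one: "toeplitz laurent_one = bimat_id"
  by (simp add: toeplitz_def laurent_one_def bimat_id_def fun_eq_iff)

text \<open>Surjectivity is built into the carrier of \<open>toeplitz_group S\<close>, which is an
  image under \<open>toeplitz\<close>.\<close>

lemma toeplitz_iso: "toeplitz \<in> iso (laurent_group S) (toeplitz_group S)"
  by (intro isoI homI)
    (auto simp: laurent_group_def toeplitz_group_def toeplitz_mult bij_betw_def
      intro: inj_on_subset[OF inj_toeplitz])

theorem theorem11:
  fixes S :: "(int \<Rightarrow> 'a::field) set"
  assumes "S = laurent_x \<or> S = laurent_inv_x"
  shows "group (laurent_group S) \<and>
    group (toeplitz_group S) \<and>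
    toeplitz_group S \<cong> laurent_group S \<and>
    (\<forall>\<alpha>\<in>S. \<forall>\<beta>\<in>S. bimat_mult_defined (toeplitz \<alpha>) (toeplitz \<beta>) \<and>
       bimat_mult (toeplitz \<alpha>) (toeplitz \<beta>) = toeplitz (laurent_mult \<alpha> \<beta>)) \<and>
    \<one>\<^bsub>toeplitz_group S\<^esub> = toeplitz laurent_one \<and>
    toeplitz laurent_one = (bimat_id :: int \<Rightarrow> int \<Rightarrow> 'a) \<and>
    (\<forall>\<alpha>\<in>S. \<alpha> \<noteq> laurent_zero \<longrightarrow>
       inv\<^bsub>toeplitz_group S\<^esub> (toeplitz \<alpha>) = toeplitz (inv\<^bsub>laurent_group S\<^esub> \<alpha>))"
proof -
  have L: "group (laurent_group S)"
    using assms group_laurent_x group_laurent_inv_x by blast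
  have iso: "toeplitz \<in> iso (laurent_group S) (toeplitz_group S)"
    by (rule toeplitz_iso)
  have one: "\<one>\<^bsub>toeplitz_group S\<^esub> = toeplitz laurent_one"
    by (simp add: toeplitz_group_def toeplitz_one)
  have T: "group (toeplitz_group S)"
    using L iso by (rule group_transport) (simp add: one laurent_group_def)
  have isom: "toeplitz_group S \<cong> laurent_group S"
    by (rule group.iso_sym[OF L is_isoI[OF iso]])
  \<comment> \<open>Homomorphisms of groups preserve inverses; \<open>hom_inv\<close> from this
    locale gives the formula for the inverse matrix.\<close>
  interpret group_hom "laurent_group S" "toeplitz_group S" toeplitz
    using L T iso by (simp add: group_hom_def group_hom_axioms_def iso_def)
  have inverse: "inv\<^bsub>toeplitz_group S\<^esub> (toeplitz \<alpha>) = toeplitz (inv\<^bsub>laurent_group S\<^esub> \<alpha>)"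
    if "\<alpha> \<in> S" "\<alpha> \<noteq> laurent_zero" for \<alpha>
    using that by (intro hom_inv[symmetric]) (simp add: laurent_group_def)
  have "bimat_mult_defined (toeplitz \<alpha>) (toeplitz \<beta>)" if "\<alpha> \<in> S" "\<beta> \<in> S" for \<alpha> \<beta>
    using assms that
    by (auto intro: toeplitz_mult_defined laurent_mult_finite_x laurent_mult_finite_inv_x)
  then show ?thesis
    using L T isom one inverse by (simp add: toeplitz_mult toeplitz_one)
qed

end
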